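(* Let $p\ge 1$. Centered ellipses (ellipses centered at the origin) are the only homothetic solutions, within $\mathcal{K}_{sym}$, of the contracting $p$-centro affine flow $\frac{\partial}{\partial t}s=-s^{1-\frac{3p}{p+2}}\mathfrak{r}^{-\frac{p}{p+2}}$. That is, a solution $\{K_t\}_{t\in[0,T)}\subset\mathcal{K}_{sym}$ of the flow is homothetic if and only if $\partial K_0$ is an ellipse centered at the origin.
   Context: $\mathcal{K}_{sym}$ denotes the set of compact, strictly convex bodies $K\subset\mathbb{R}^2$, centrally symmetric about the origin, that are smoothly embedded, i.e. whose Gauss parametrization (by the outward unit normal $z=(\cos\theta,\sin\theta)$) is a smooth embedding of $\mathbb{S}^1$; in particular the curvature $\kappa$ of the boundary is positive. For $K\in\mathcal{K}_{sym}$, $s=s(\theta)$ is the support function and $\mathfrak r=1/\kappa=s_{\theta\theta}+s$ is the radius of curvature, as functions on $\mathbb{S}^1$. A family $K_t\in\mathcal{K}_{sym}$ solves the flow if its support functions $s(\theta,t)$ satisfy the displayed equation. A solution is homothetic if $K_t=\lambda(t)K_0$ for some scalar function $\lambda(t)>0$ for all $t\in[0,T)$. *)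

theory Defs
  imports "HOL-Analysis.Analysis"
begin

definition unit_normal :: "real \<Rightarrow> real^2" where
  "unit_normal \<theta> = vector [cos \<theta>, sin \<theta>]"

definition smooth :: "(real \<Rightarrow> 'a::real_normed_vector) \<Rightarrow> bool" where
  "smooth f \<longleftrightarrow> (\<exists>D :: nat \<Rightarrow> real \<Rightarrow> 'a. D 0 = f \<and>
     (\<forall>n x. (D n has_vector_derivative D (Suc n) x) (at x)))"

text \<open>Smoothness of a map on the unit circle is tested on its pullback along the covering
  map \<^const>\<open>unit_normal\<close>, which is a local diffeomorphism.\<close>

definition smooth_circle_embedding :: "(real^2 \<Rightarrow> real^2) \<Rightarrow> bool" where
  "smooth_circle_embedding G \<longleftrightarrow>
     smooth (\<lambda>\<theta>. G (unit_normal \<theta>)) \<and>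
     (\<forall>\<theta>. vector_derivative (\<lambda>\<theta>. G (unit_normal \<theta>)) (at \<theta>) \<noteq> 0) \<and>
     (\<exists>H. homeomorphism (sphere 0 1) (G ` sphere 0 1) G H)"

definition strictly_convex :: "(real^2) set \<Rightarrow> bool" where
  "strictly_convex K \<longleftrightarrow> convex K \<and>
     (\<forall>x\<in>K. \<forall>y\<in>K. x \<noteq> y \<longrightarrow> open_segment x y \<subseteq> interior K)"

text \<open>The point of \<open>K\<close> at which \<open>z\<close> is an outward normal; it is unique
  when \<open>K\<close> is nonempty, compact and strictly convex and \<open>z \<noteq> 0\<close>.\<close>

definition gauss_param :: "(real^2) set \<Rightarrow> real^2 \<Rightarrow> real^2" where
  "gauss_param K z = (THE x. x \<in> K \<and> (\<forall>y\<in>K. y \<bullet> z \<le> x \<bullet> z))"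

definition K_sym :: "(real^2) set set" where
  "K_sym = {K. compact K \<and> interior K \<noteq> {} \<and> strictly_convex K \<and>
     uminus ` K = K \<and> smooth_circle_embedding (gauss_param K)}"

definition support :: "(real^2) set \<Rightarrow> real \<Rightarrow> real" where
  "support K \<theta> = (SUP x\<in>K. x \<bullet> unit_normal \<theta>)"

definition curvature_radius :: "(real^2) set \<Rightarrow> real \<Rightarrow> real" where
  "curvature_radius K \<theta> = deriv (deriv (support K)) \<theta> + support K \<theta>"

text \<open>The time derivative is one-sided at \<open>t = 0\<close>. No joint regularity in
  \<open>(\<theta>, t)\<close> is required beyond the equation itself.\<close>

definition centro_affine_flow :: "real \<Rightarrow> real \<Rightarrow> (real \<Rightarrow> (real^2) set) \<Rightarrow> bool" where
  "centro_affine_flow p T K \<longleftrightarrow>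
     (\<forall>t\<in>{0..<T}. K t \<in> K_sym) \<and>
     (\<forall>\<theta>. \<forall>t\<in>{0..<T}.
        ((\<lambda>\<tau>. support (K \<tau>) \<theta>) has_real_derivative
           - (support (K t) \<theta> powr (1 - 3 * p / (p + 2)) *
              curvature_radius (K t) \<theta> powr (- (p / (p + 2)))))
        (at t within {0..<T}))"

definition homothetic_solution :: "real \<Rightarrow> (real \<Rightarrow> (real^2) set) \<Rightarrow> bool" where
  "homothetic_solution T K \<longleftrightarrow>
     (\<exists>c::real \<Rightarrow> real. \<forall>t\<in>{0..<T}. c t > 0 \<and> K t = (\<lambda>x. c t *\<^sub>R x) ` K 0)"

definition centered_ellipse :: "(real^2) set \<Rightarrow> bool" where
  "centered_ellipse E \<longleftrightarrow>
     (\<exists>a b :: real. \<exists>u v :: real^2. a > 0 \<and> b > 0 \<and>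
        norm u = 1 \<and> norm v = 1 \<and> u \<bullet> v = 0 \<and>
        E = {x. (x \<bullet> u)\<^sup>2 / a\<^sup>2 + (x \<bullet> v)\<^sup>2 / b\<^sup>2 = 1})"

end

theory Submission
  imports Defs
begin

text \<open>
  Write \<open>s\<close> for the support function, \<open>r = s'' + s\<close> for the radius of curvature and
  \<open>\<alpha> = p / (p + 2)\<close>. The speed of the flow factors as \<open>s\<^sub>t = - s (s\<^sup>3 r) powr (- \<alpha>)\<close>
  (\<open>flow_speed\<close>), so everything is governed by the centro-affine quantity
  \<open>s\<^sup>3 r\<close>.

  If the solution is homothetic, then \<open>s\<^sub>t / s\<close> does not depend on the angle, hence neither does
  \<open>s\<^sup>3 r\<close>: at time zero \<open>s'' + s = C / s\<^sup>3\<close> with a constant \<open>C\<close>. This Ermakov equation is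
  linearized by squaring: for a conserved energy \<open>2 E\<close> the function \<open>s\<^sup>2 - E\<close> satisfies
  \<open>w'' = - 4 w\<close>, so \<open>s\<^sup>2\<close> is a quadratic form in the unit normal and \<open>s\<close> is the support function
  of a centered ellipse (\<open>ermakov_solution\<close>). A compact convex set is determined by its support
  function.

  If the solution starts from an ellipse with support function \<open>h\<close>, then \<open>h\<^sup>3 (h'' + h) = C\<close>, and
  homothetic shrinking is one solution of the flow; the content of the claim is uniqueness.
  For an arbitrary solution put \<open>u = s / h\<close>. Where \<open>u(\<sqdot>, t)\<close> is maximal, the body touches a
  scaled copy of the ellipse from inside, so \<open>r \<le> u (h'' + h)\<close> there
  (\<open>curvature_radius_le_at_contact\<close>). Inserting this into the flow shows that
  \<open>u powr (4 \<alpha>) + 4 \<alpha> C powr (- \<alpha>) t\<close> is non-increasing in time at its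
  spatial maxima and, symmetrically, non-decreasing at its spatial minima. It equals one
  initially, so the maximum principle (\<open>parabolic_maximum_principle\<close>) keeps it equal to one,
  and \<open>u\<close> depends on time only (\<open>ellipse_flow_support\<close>). The maximum principle
  needs \<open>s\<close> to be jointly continuous, although the flow equation is only given angle by angle:
  the bodies shrink, so their support functions share a modulus of continuity in the angle
  (\<open>flow_support_continuous\<close>).
\<close>

section \<open>Planar convex sets and their support functions\<close>

lemma unit_normal_nth [simp]:
  "unit_normal \<theta> $ 1 = cos \<theta>" "unit_normal \<theta> $ 2 = sin \<theta>"
  by (simp_all add: unit_normal_def)

lemma inner_plane: "x \<bullet> y = x $ 1 * y $ 1 + x $ 2 * y $ 2" for x y :: "real^2"
  by (simp add: inner_vec_def sum_2)

lemma inner_unit_normal: "unit_normal \<theta> \<bullet> unit_normal \<phi> = cos (\<theta> - \<phi>)"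
  by (simp add: inner_plane cos_diff)

lemma norm_unit_normal [simp]: "norm (unit_normal \<theta>) = 1"
  by (simp add: norm_eq_sqrt_inner inner_unit_normal)

lemma polar_form:
  fixes x :: "real^2"
  obtains \<phi> where "x = norm x *\<^sub>R unit_normal \<phi>"
proof (cases "x = 0")
  case False
  have "(x $ 1 / norm x)\<^sup>2 + (x $ 2 / norm x)\<^sup>2 = (x \<bullet> x) / (norm x)\<^sup>2"
    by (simp add: inner_plane power2_eq_square add_divide_distrib)
  also have "\<dots> = 1"
    using False by (simp add: power2_norm_eq_inner)
  finally obtain \<phi> where \<phi>: "x $ 1 / norm x = cos \<phi>" "x $ 2 / norm x = sin \<phi>"
    by (rule sincos_total_2pi)
  have "x $ i = norm x * unit_normal \<phi> $ i" if "i = 1 \<or> i = 2" for i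
    using that False by (auto simp flip: \<phi>)
  then have "x = norm x *\<^sub>R unit_normal \<phi>"
    by (simp only: vec_eq_iff forall_2 vector_scaleR_component real_scaleR_def) blast
  then show ?thesis by (rule that)
next
  case True
  show ?thesis by (rule that[of 0]) (simp add: True)
qed

lemma unit_normal_frame:
  "unit_normal (\<theta> + pi/2) \<bullet> unit_normal \<theta> = 0"
  "x = (x \<bullet> unit_normal \<theta>) *\<^sub>R unit_normal \<theta>
       + (x \<bullet> unit_normal (\<theta> + pi/2)) *\<^sub>R unit_normal (\<theta> + pi/2)"
proof -
  show "unit_normal (\<theta> + pi/2) \<bullet> unit_normal \<theta> = 0"
    by (simp add: inner_unit_normal)
  have c: "cos \<theta> * (cos \<theta> * y) = y - sin \<theta> * (sin \<theta> * y)" for y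
  proof -
    have "cos \<theta> * (cos \<theta> * y) = (cos \<theta>)\<^sup>2 * y" by (simp add: power2_eq_square)
    also have "\<dots> = (1 - (sin \<theta>)\<^sup>2) * y" by (simp only: cos_squared_eq)
    finally show ?thesis by (simp add: power2_eq_square left_diff_distrib)
  qed
  show "x = (x \<bullet> unit_normal \<theta>) *\<^sub>R unit_normal \<theta>
       + (x \<bullet> unit_normal (\<theta> + pi/2)) *\<^sub>R unit_normal (\<theta> + pi/2)"
    by (simp add: vec_eq_iff forall_2 inner_plane cos_add sin_add)
       (simp add: algebra_simps c)
qed

lemma has_vector_derivative_unit_normal:
  "(unit_normal has_vector_derivative unit_normal (\<theta> + pi/2)) (at \<theta>)"
proof -
  have eq: "unit_normal = (\<lambda>\<theta>. cos \<theta> *\<^sub>R axis 1 1 + sin \<theta> *\<^sub>R axis 2 1)"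
    by (auto simp: fun_eq_iff vec_eq_iff forall_2 axis_def)
  show ?thesis
    by (subst eq)
       (auto intro!: derivative_eq_intros
             simp: vec_eq_iff forall_2 axis_def cos_add sin_add)
qed

lemma continuous_on_unit_normal: "continuous_on S unit_normal"
  by (meson continuous_at_imp_continuous_on has_vector_derivative_continuous
      has_vector_derivative_unit_normal)

lemma support_attained:
  assumes "compact K" "K \<noteq> {}"
  obtains x where "x \<in> K" "\<And>y. y \<in> K \<Longrightarrow> y \<bullet> unit_normal \<theta> \<le> x \<bullet> unit_normal \<theta>"
    "support K \<theta> = x \<bullet> unit_normal \<theta>"
proof -
  obtain x where x: "x \<in> K" "\<forall>y\<in>K. y \<bullet> unit_normal \<theta> \<le> x \<bullet> unit_normal \<theta>"
    using continuous_attains_sup[OF assms, of "\<lambda>x. x \<bullet> unit_normal \<theta>"]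
      continuous_on_inner[OF continuous_on_id continuous_on_const] by blast
  then have "support K \<theta> = x \<bullet> unit_normal \<theta>"
    unfolding support_def by (intro cSup_eq_maximum) auto
  with x show ?thesis using that by blast
qed

lemma inner_le_support:
  assumes "compact K" "x \<in> K"
  shows "x \<bullet> unit_normal \<theta> \<le> support K \<theta>"
  using support_attained[OF assms(1), of \<theta>] assms(2) by (metis empty_iff)

text \<open>A point outside \<open>L\<close> is separated from \<open>L\<close> by a line, and the normal of that line is
  a direction in which the support function of \<open>L\<close> is too small.\<close>

lemma support_subset:
  assumes K: "compact K" and L: "compact L" "convex L" "L \<noteq> {}"
    and le: "\<And>\<theta>. support K \<theta> \<le> support L \<theta>"
  shows "K \<subseteq> L"
proof
  fix x assume x: "x \<in> K"
  show "x \<in> L"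
  proof (rule ccontr)
    assume "x \<notin> L"
    then obtain a b where ab: "a \<bullet> x < b" "\<And>y. y \<in> L \<Longrightarrow> a \<bullet> y > b"
      using separating_hyperplane_closed_point[OF L(2) compact_imp_closed[OF L(1)]] by metis
    obtain \<phi> where \<phi>: "- a = norm (- a) *\<^sub>R unit_normal \<phi>"
      by (rule polar_form)
    have inner_a: "norm a * (y \<bullet> unit_normal \<phi>) = - (a \<bullet> y)" for y
      using arg_cong[OF \<phi>, of "\<lambda>w. y \<bullet> w"] by (simp add: inner_commute)
    obtain y where y: "y \<in> L" "support L \<phi> = y \<bullet> unit_normal \<phi>"
      using support_attained[OF L(1,3)] by metis
    have "x \<bullet> unit_normal \<phi> \<le> y \<bullet> unit_normal \<phi>"
      using inner_le_support[OF K x] le[of \<phi>] y by (metis order_trans)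
    then have "norm a * (x \<bullet> unit_normal \<phi>) \<le> norm a * (y \<bullet> unit_normal \<phi>)"
      by (simp add: mult_left_mono)
    then show False
      using inner_a ab(1) ab(2)[OF y(1)] by simp
  qed
qed

lemma support_inject:
  assumes "compact K" "convex K" "K \<noteq> {}" "compact L" "convex L" "L \<noteq> {}"
    and "\<And>\<theta>. support K \<theta> = support L \<theta>"
  shows "K = L"
proof
  show "K \<subseteq> L"
    by (rule support_subset[OF assms(1,4,5,6)]) (simp add: assms(7))
  show "L \<subseteq> K"
    by (rule support_subset[OF assms(4,1,2,3)]) (simp add: assms(7))
qed

lemma support_scaleR:
  assumes "compact K" "K \<noteq> {}" "c \<ge> 0"
  shows "support ((\<lambda>x. c *\<^sub>R x) ` K) \<theta> = c * support K \<theta>"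
proof -
  obtain x where x: "x \<in> K" "\<And>y. y \<in> K \<Longrightarrow> y \<bullet> unit_normal \<theta> \<le> x \<bullet> unit_normal \<theta>"
    "support K \<theta> = x \<bullet> unit_normal \<theta>"
    using support_attained[OF assms(1,2)] by metis
  have "(SUP y\<in>(\<lambda>x. c *\<^sub>R x) ` K. y \<bullet> unit_normal \<theta>) = c * (x \<bullet> unit_normal \<theta>)"
  proof (rule cSup_eq_maximum)
    have "c * (x \<bullet> unit_normal \<theta>) = (c *\<^sub>R x) \<bullet> unit_normal \<theta>" by simp
    then show "c * (x \<bullet> unit_normal \<theta>) \<in> (\<lambda>y. y \<bullet> unit_normal \<theta>) ` (\<lambda>x. c *\<^sub>R x) ` K"
      using x(1) by blast
  qed (use x assms(3) in \<open>auto intro!: mult_left_mono\<close>)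
  then show ?thesis using x by (simp add: support_def)
qed

text \<open>The Lipschitz constant depends only on a disc that contains the body, so the support functions of
  all bodies in one disc are equicontinuous.\<close>

lemma support_shift_le:
  assumes "compact K" "K \<noteq> {}" and R: "\<And>x. x \<in> K \<Longrightarrow> norm x \<le> R"
  shows "\<bar>support K \<theta> - support K \<phi>\<bar> \<le> R * norm (unit_normal \<theta> - unit_normal \<phi>)"
proof -
  have *: "support K \<theta> - support K \<phi> \<le> R * norm (unit_normal \<theta> - unit_normal \<phi>)" for \<theta> \<phi>
  proof -
    obtain x where x: "x \<in> K" "support K \<theta> = x \<bullet> unit_normal \<theta>"
      using support_attained[OF assms(1,2)] by metis
    have "support K \<theta> - support K \<phi> \<le> x \<bullet> (unit_normal \<theta> - unit_normal \<phi>)"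
      using x inner_le_support[OF assms(1) x(1), of \<phi>] by (simp add: inner_diff_right)
    also have "\<dots> \<le> norm x * norm (unit_normal \<theta> - unit_normal \<phi>)"
      by (rule norm_cauchy_schwarz)
    also have "\<dots> \<le> R * norm (unit_normal \<theta> - unit_normal \<phi>)"
      using R[OF x(1)] by (rule mult_right_mono) simp
    finally show ?thesis .
  qed
  show ?thesis
    using *[of \<theta> \<phi>] *[of \<phi> \<theta>] by (simp add: norm_minus_commute abs_le_iff)
qed

section \<open>Second derivatives at extrema and the maximum principle\<close>

text \<open>The second derivative is assumed at the single point \<open>x0\<close>, so there is no Taylor
  expansion with remainder: a negative \<open>f2\<close> makes \<open>f1\<close> negative just to the right of \<open>x0\<close>.\<close>

lemma second_derivative_nonneg_at_min:
  fixes f f1 :: "real \<Rightarrow> real"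
  assumes f: "\<And>x. (f has_real_derivative f1 x) (at x)"
    and f1: "(f1 has_real_derivative f2) (at x0)"
    and min: "\<And>y. f x0 \<le> f y"
  shows "0 \<le> f2"
proof (rule ccontr)
  assume "\<not> 0 \<le> f2"
  then obtain d where d: "d > 0" "\<And>h. 0 < h \<Longrightarrow> h < d \<Longrightarrow> f1 (x0 + h) < f1 x0"
    using DERIV_neg_dec_right[OF f1] by force
  have 0: "f1 x0 = 0"
    using DERIV_local_min[OF f[of x0], of 1] min by auto
  obtain z where z: "z > x0" "z < x0 + d/2" "f (x0 + d/2) - f x0 = (x0 + d/2 - x0) * f1 z"
    using MVT2[of x0 "x0 + d/2" f f1] d(1) f by auto
  have "f1 z < 0"
    using d(2)[of "z - x0"] z d(1) 0 by auto
  then have "f (x0 + d/2) - f x0 < 0"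
    using z(3) mult_pos_neg[of "d/2" "f1 z"] d(1) by simp
  with min[of "x0 + d/2"] show False by simp
qed

text \<open>The differential inequality is used only at spatial maxima. A small tilt \<open>- e t\<close> turns a
  violation of the bound into a positive time of a space-time maximum, where the time derivative
  of the tilted function would have to be nonnegative but is at most \<open>- e\<close>. The hypothesis \<open>per\<close>
  replaces periodicity and makes the maximum over one period global.\<close>

lemma parabolic_maximum_principle:
  fixes v D :: "real \<Rightarrow> real \<Rightarrow> real"
  assumes cont: "continuous_on ({0..2*pi} \<times> {0..<T}) (\<lambda>(\<theta>, t). v \<theta> t)"
    and per: "\<And>\<theta>. \<exists>\<phi>\<in>{0..2*pi}. \<forall>t\<in>{0..<T}. v \<theta> t = v \<phi> t"
    and deriv: "\<And>\<theta> t. t \<in> {0..<T} \<Longrightarrow> (v \<theta> has_real_derivative D \<theta> t) (at t within {0..<T})"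
    and crit: "\<And>\<theta> t. t \<in> {0..<T} \<Longrightarrow> (\<And>\<phi>. v \<phi> t \<le> v \<theta> t) \<Longrightarrow> D \<theta> t \<le> 0"
    and init: "\<And>\<theta>. v \<theta> 0 \<le> M"
    and t: "t \<in> {0..<T}"
  shows "v \<theta> t \<le> M"
proof (rule ccontr)
  assume "\<not> v \<theta> t \<le> M"
  then obtain \<theta>1 where \<theta>1: "\<theta>1 \<in> {0..2*pi}" "v \<theta>1 t > M"
    using per[of \<theta>] t by (metis not_le)
  have "t > 0"
    using \<theta>1(2) init[of \<theta>1] t by (cases "t = 0") auto
  \<comment> \<open>With this tilt, half of the excess at \<open>(\<theta>1, t)\<close> survives.\<close>
  define e where "e = (v \<theta>1 t - M) / (2 * t)"
  have e: "e > 0" "v \<theta>1 t - e * t > M"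
    using \<open>t > 0\<close> \<theta>1(2) by (auto simp: e_def field_simps)
  let ?w = "\<lambda>(\<theta>, s). v \<theta> s - e * s"
  have "continuous_on ({0..2*pi} \<times> {0..t}) (\<lambda>(\<theta>, s). v \<theta> s)"
    using t by (intro continuous_on_subset[OF cont]) auto
  then have "continuous_on ({0..2*pi} \<times> {0..t}) ?w"
    unfolding case_prod_unfold by (intro continuous_intros)
  moreover have "compact ({0..2*pi} \<times> {0..t})" by (intro compact_Times) auto
  moreover have "{0..2*pi} \<times> {0..t} \<noteq> {}" using t by auto
  ultimately obtain q where q: "q \<in> {0..2*pi} \<times> {0..t}"
      "\<forall>y\<in>{0..2*pi} \<times> {0..t}. ?w y \<le> ?w q"
    using continuous_attains_sup[of "{0..2*pi} \<times> {0..t}" ?w] by blast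
  obtain \<theta>0 t0 where [simp]: "q = (\<theta>0, t0)" by force
  have t0: "\<theta>0 \<in> {0..2*pi}" "t0 \<in> {0..t}" "t0 \<in> {0..<T}" using q t by auto
  have max: "v \<phi> s - e * s \<le> v \<theta>0 t0 - e * t0" if "\<phi> \<in> {0..2*pi}" "s \<in> {0..t}" for \<phi> s
    using q(2) that by fastforce
  have "v \<theta>0 t0 - e * t0 > M"
    using max[OF \<theta>1(1), of t] e t by auto
  then have "t0 > 0"
    using init[of \<theta>0] t0 by (cases "t0 = 0") auto
  have "v \<phi> t0 \<le> v \<theta>0 t0" for \<phi>
  proof -
    obtain \<phi>' where "\<phi>' \<in> {0..2*pi}" "v \<phi> t0 = v \<phi>' t0"
      using per[of \<phi>] t0(3) by blast
    then show ?thesis using max[of \<phi>' t0] t0 by auto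
  qed
  then have D: "D \<theta>0 t0 \<le> 0"
    using crit t0(3) by blast
  have "(v \<theta>0 has_real_derivative D \<theta>0 t0) (at t0 within {0<..<T})"
    by (rule DERIV_subset[OF deriv[OF t0(3)]]) auto
  then have "(v \<theta>0 has_real_derivative D \<theta>0 t0) (at t0)"
    using \<open>t0 > 0\<close> t0(3) by (subst (asm) at_within_open) auto
  then have "((\<lambda>s. v \<theta>0 s - e * s) has_real_derivative D \<theta>0 t0 - e) (at t0)"
    by (auto intro!: derivative_eq_intros)
  moreover have "D \<theta>0 t0 - e < 0" using D e(1) by simp
  ultimately obtain d where d: "d > 0"
      "\<And>h. 0 < h \<Longrightarrow> h < d \<Longrightarrow> v \<theta>0 t0 - e * t0 < v \<theta>0 (t0 - h) - e * (t0 - h)"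
    using DERIV_neg_dec_left by blast
  \<comment> \<open>As \<open>t0\<close> can be the last time considered, only the past \<open>t0 - h\<close> can be compared.\<close>
  define h where "h = min (d/2) t0"
  have h: "0 < h" "h < d" "h \<le> t0" using d(1) \<open>t0 > 0\<close> by (auto simp: h_def)
  show False
    using d(2)[OF h(1,2)] max[OF t0(1), of "t0 - h"] h t0 by auto
qed

section \<open>Regularity of the bodies in the class\<close>

lemma inner_less_of_interior:
  assumes "x \<in> interior K"
  obtains y where "y \<in> K" "x \<bullet> unit_normal \<theta> < y \<bullet> unit_normal \<theta>"
proof -
  obtain e where e: "e > 0" "ball x e \<subseteq> K"
    using assms by (meson mem_interior)
  have "x + (e/2) *\<^sub>R unit_normal \<theta> \<in> K"
    using e by (intro subsetD[OF e(2)]) (simp add: dist_norm)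
  moreover have "x \<bullet> unit_normal \<theta> < (x + (e/2) *\<^sub>R unit_normal \<theta>) \<bullet> unit_normal \<theta>"
    using e(1) by (simp add: inner_add_left inner_unit_normal)
  ultimately show ?thesis by (rule that)
qed

text \<open>Two different support points would have their midpoint in the interior, and interior points
  never maximize a linear functional. So the description defining the Gauss parametrization
  denotes.\<close>

lemma gauss_param_maximizes:
  assumes K: "compact K" "interior K \<noteq> {}" "strictly_convex K"
  shows "gauss_param K (unit_normal \<theta>) \<in> K"
    and "y \<in> K \<Longrightarrow> y \<bullet> unit_normal \<theta> \<le> gauss_param K (unit_normal \<theta>) \<bullet> unit_normal \<theta>"
proof -
  define P where "P x \<longleftrightarrow> x \<in> K \<and> (\<forall>y\<in>K. y \<bullet> unit_normal \<theta> \<le> x \<bullet> unit_normal \<theta>)" for x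
  have "K \<noteq> {}" using K(2) interior_subset by blast
  obtain x where "x \<in> K" "\<And>y. y \<in> K \<Longrightarrow> y \<bullet> unit_normal \<theta> \<le> x \<bullet> unit_normal \<theta>"
    using support_attained[OF K(1) \<open>K \<noteq> {}\<close>] by metis
  then have x: "P x" by (simp add: P_def)
  have "z = x" if z: "P z" for z
  proof (rule ccontr)
    assume "z \<noteq> x"
    then have "midpoint z x \<in> open_segment z x" by simp
    moreover have "open_segment z x \<subseteq> interior K"
      using K(3) x z \<open>z \<noteq> x\<close> unfolding strictly_convex_def P_def by blast
    ultimately have "midpoint z x \<in> interior K" by blast
    then obtain y where "y \<in> K" "midpoint z x \<bullet> unit_normal \<theta> < y \<bullet> unit_normal \<theta>"
      by (rule inner_less_of_interior)
    moreover have "z \<bullet> unit_normal \<theta> = x \<bullet> unit_normal \<theta>"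
      using x z unfolding P_def by (meson order_antisym)
    moreover have "y \<bullet> unit_normal \<theta> \<le> x \<bullet> unit_normal \<theta>"
      using x \<open>y \<in> K\<close> unfolding P_def by blast
    ultimately show False
      by (simp add: midpoint_def inner_add_left)
  qed
  with x have "P (gauss_param K (unit_normal \<theta>))"
    unfolding gauss_param_def P_def[symmetric] by (rule theI)
  then show "gauss_param K (unit_normal \<theta>) \<in> K"
    "y \<in> K \<Longrightarrow> y \<bullet> unit_normal \<theta> \<le> gauss_param K (unit_normal \<theta>) \<bullet> unit_normal \<theta>"
    by (auto simp: P_def)
qed

lemma K_symD:
  assumes "K \<in> K_sym"
  shows "compact K" "convex K" "K \<noteq> {}" "interior K \<noteq> {}"
  using assms interior_subset by (auto simp: K_sym_def strictly_convex_def)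

text \<open>Symmetry puts the origin between an interior point \<open>x\<close> and \<open>- x\<close>; the inequality is strict
  because \<open>x\<close> does not maximize.\<close>

lemma support_pos:
  assumes "K \<in> K_sym"
  shows "support K \<theta> > 0"
proof -
  obtain x where x: "x \<in> interior K" using K_symD(4)[OF assms] by blast
  obtain y where y: "y \<in> K" "x \<bullet> unit_normal \<theta> < y \<bullet> unit_normal \<theta>"
    using x by (rule inner_less_of_interior)
  have "- x \<in> uminus ` K" using x interior_subset by blast
  then have "- x \<in> K" using assms by (simp add: K_sym_def)
  then show ?thesis
    using inner_le_support[OF K_symD(1)[OF assms], of "-x" \<theta>]
      inner_le_support[OF K_symD(1)[OF assms] y(1), of \<theta>] y(2) by simp
qed

lemma has_vector_derivative_unit_normal_turned:
  "((\<lambda>\<theta>. unit_normal (\<theta> + pi/2)) has_vector_derivative - unit_normal \<theta>) (at \<theta>)"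
proof -
  have eq: "(\<lambda>\<theta>. unit_normal (\<theta> + pi/2)) = (\<lambda>\<theta>. (- sin \<theta>) *\<^sub>R axis 1 1 + cos \<theta> *\<^sub>R axis 2 1)"
    by (auto simp: fun_eq_iff vec_eq_iff forall_2 axis_def cos_add sin_add)
  show ?thesis
    by (subst eq)
       (auto intro!: derivative_eq_intros simp: vec_eq_iff forall_2 axis_def)
qed

lemma has_real_derivative_inner:
  fixes f g :: "real \<Rightarrow> 'a::real_inner"
  assumes "(f has_vector_derivative f') (at x)" "(g has_vector_derivative g') (at x)"
  shows "((\<lambda>x. f x \<bullet> g x) has_real_derivative f x \<bullet> g' + f' \<bullet> g x) (at x)"
  unfolding has_real_derivative_iff_has_vector_derivative
  by (rule bounded_bilinear.has_vector_derivative[OF bounded_bilinear_inner assms])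

text \<open>Let \<open>G\<close> be the boundary point as a function of the angle. Since \<open>G\<close> maximizes the product with
  its own normal, \<open>G'\<close> is tangential; hence \<open>s = G \<bullet> n\<close> has derivative \<open>G \<bullet> n'\<close>,
  which can be differentiated once more, and \<open>s'' + s = G' \<bullet> n'\<close>. This is nonnegative since
  the body lies in its supporting half-planes, and nonzero since \<open>G\<close> is an immersion.\<close>

lemma K_sym_support_C2:
  assumes "K \<in> K_sym"
  obtains s1 where
    "\<And>\<theta>. (support K has_real_derivative s1 \<theta>) (at \<theta>)"
    "\<And>\<theta>. (s1 has_real_derivative curvature_radius K \<theta> - support K \<theta>) (at \<theta>)"
    "\<And>\<theta>. curvature_radius K \<theta> > 0"
proof -
  note K = K_symD[OF assms]
  have sc: "strictly_convex K" using assms by (simp add: K_sym_def)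
  let ?n = unit_normal
  define G where "G \<theta> = gauss_param K (?n \<theta>)" for \<theta>
  have G: "G \<theta> \<in> K" "y \<in> K \<Longrightarrow> y \<bullet> ?n \<theta> \<le> G \<theta> \<bullet> ?n \<theta>" for \<theta> y
    unfolding G_def using gauss_param_maximizes[OF K(1,4) sc] by blast+
  have "smooth G" and nz: "vector_derivative G (at \<theta>) \<noteq> 0" for \<theta>
    using assms unfolding K_sym_def smooth_circle_embedding_def G_def[abs_def] by auto
  then obtain G1 where G1: "(G has_vector_derivative G1 \<theta>) (at \<theta>)" for \<theta>
    unfolding smooth_def by metis
  with nz have G1_nz: "G1 \<theta> \<noteq> 0" for \<theta>
    by (metis vector_derivative_at)
  have s: "support K = (\<lambda>\<theta>. G \<theta> \<bullet> ?n \<theta>)"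
  proof
    fix \<theta>
    obtain x where "x \<in> K" "support K \<theta> = x \<bullet> ?n \<theta>"
      using support_attained[OF K(1,3)] by metis
    then show "support K \<theta> = G \<theta> \<bullet> ?n \<theta>"
      using G(2)[of x \<theta>] inner_le_support[OF K(1) G(1), of \<theta> \<theta>] by simp
  qed
  have tangent: "G1 \<theta> \<bullet> ?n \<theta> = 0" for \<theta>
  proof (rule DERIV_local_max)
    show "((\<lambda>\<phi>. G \<phi> \<bullet> ?n \<theta>) has_real_derivative G1 \<theta> \<bullet> ?n \<theta>) (at \<theta>)"
      using has_real_derivative_inner[OF G1 has_vector_derivative_const] by simp
    show "\<forall>\<phi>. \<bar>\<theta> - \<phi>\<bar> < 1 \<longrightarrow> G \<phi> \<bullet> ?n \<theta> \<le> G \<theta> \<bullet> ?n \<theta>"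
      using G by blast
  qed simp
  define s1 where "s1 \<theta> = G \<theta> \<bullet> ?n (\<theta> + pi/2)" for \<theta>
  have ds: "(support K has_real_derivative s1 \<theta>) (at \<theta>)" for \<theta>
    using has_real_derivative_inner[OF G1 has_vector_derivative_unit_normal, of \<theta>]
    by (simp add: s s1_def tangent)
  have ds1: "(s1 has_real_derivative G1 \<theta> \<bullet> ?n (\<theta> + pi/2) - support K \<theta>) (at \<theta>)" for \<theta>
    using has_real_derivative_inner[OF G1 has_vector_derivative_unit_normal_turned, of \<theta>]
    by (simp add: s s1_def[abs_def])
  have "deriv (support K) = s1" using ds by (intro ext DERIV_imp_deriv)
  then have r: "curvature_radius K \<theta> = G1 \<theta> \<bullet> ?n (\<theta> + pi/2)" for \<theta>
    using DERIV_imp_deriv[OF ds1] by (simp add: curvature_radius_def)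
  have lin: "((\<lambda>\<phi>. x \<bullet> ?n \<phi>) has_real_derivative x \<bullet> ?n (\<phi> + pi/2)) (at \<phi>)" for x \<phi>
    using has_real_derivative_inner
      [OF has_vector_derivative_const has_vector_derivative_unit_normal] by simp
  have lin1: "((\<lambda>\<phi>. x \<bullet> ?n (\<phi> + pi/2)) has_real_derivative - (x \<bullet> ?n \<phi>)) (at \<phi>)" for x \<phi>
    using has_real_derivative_inner
      [OF has_vector_derivative_const has_vector_derivative_unit_normal_turned] by simp
  have r_nonneg: "G1 \<theta> \<bullet> ?n (\<theta> + pi/2) \<ge> 0" for \<theta>
  proof -
    \<comment> \<open>The support function of the point \<open>G \<theta>\<close> touches that of \<open>K\<close> from below at \<open>\<theta>\<close>.\<close>
    have "((\<lambda>\<phi>. support K \<phi> - G \<theta> \<bullet> ?n \<phi>) has_real_derivative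
        s1 \<phi> - G \<theta> \<bullet> ?n (\<phi> + pi/2)) (at \<phi>)" for \<phi>
      by (rule DERIV_diff[OF ds lin])
    moreover have "((\<lambda>\<phi>. s1 \<phi> - G \<theta> \<bullet> ?n (\<phi> + pi/2)) has_real_derivative
        G1 \<theta> \<bullet> ?n (\<theta> + pi/2)) (at \<theta>)"
      using DERIV_diff[OF ds1[of \<theta>] lin1[where x = "G \<theta>"]] by (simp add: s)
    moreover have "support K \<theta> - G \<theta> \<bullet> ?n \<theta> \<le> support K \<phi> - G \<theta> \<bullet> ?n \<phi>" for \<phi>
      using inner_le_support[OF K(1) G(1), of \<theta> \<phi>] by (simp add: s)
    ultimately show ?thesis by (rule second_derivative_nonneg_at_min)
  qed
  have "G1 \<theta> \<bullet> ?n (\<theta> + pi/2) \<noteq> 0" for \<theta>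
  proof
    assume "G1 \<theta> \<bullet> ?n (\<theta> + pi/2) = 0"
    then have "G1 \<theta> = 0"
      using unit_normal_frame(2)[of "G1 \<theta>" \<theta>] tangent by simp
    with G1_nz show False by blast
  qed
  with r_nonneg r have "curvature_radius K \<theta> > 0" for \<theta>
    by (simp add: order_less_le)
  with ds ds1 r show ?thesis by (intro that) auto
qed

section \<open>Ellipses\<close>

definition ellipse_support :: "real \<Rightarrow> real \<Rightarrow> real \<Rightarrow> real \<Rightarrow> real" where
  "ellipse_support a b \<phi> \<theta> = sqrt ((a * cos (\<theta> - \<phi>))\<^sup>2 + (b * sin (\<theta> - \<phi>))\<^sup>2)"

text \<open>Ellipses are linear images of the unit disc: compactness, convexity and the frontier
  are inherited from the disc, and the support function comes from the adjoint map.\<close>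

definition ellipse_map :: "real \<Rightarrow> real \<Rightarrow> real \<Rightarrow> real^2 \<Rightarrow> real^2" where
  "ellipse_map a b \<phi> y =
     (a * y $ 1) *\<^sub>R unit_normal \<phi> + (b * y $ 2) *\<^sub>R unit_normal (\<phi> + pi/2)"

definition solid_ellipse :: "real \<Rightarrow> real \<Rightarrow> real \<Rightarrow> (real^2) set" where
  "solid_ellipse a b \<phi> = ellipse_map a b \<phi> ` cball 0 1"

lemma linear_ellipse_map: "linear (ellipse_map a b \<phi>)"
  by (rule linearI) (simp_all add: ellipse_map_def algebra_simps)

lemma ellipse_map_coordinates:
  "ellipse_map a b \<phi> y \<bullet> unit_normal \<phi> = a * y $ 1"
  "ellipse_map a b \<phi> y \<bullet> unit_normal (\<phi> + pi/2) = b * y $ 2"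
  by (simp_all add: ellipse_map_def inner_add_left inner_unit_normal cos_add)

lemma ellipse_map_inverse:
  assumes "a > 0" "b > 0"
  shows "ellipse_map a b \<phi>
    (vector [x \<bullet> unit_normal \<phi> / a, x \<bullet> unit_normal (\<phi> + pi/2) / b]) = x"
  using unit_normal_frame(2)[of x \<phi>] assms by (simp add: ellipse_map_def)

lemma bij_ellipse_map:
  assumes "a > 0" "b > 0"
  shows "bij (ellipse_map a b \<phi>)"
proof (rule bijI)
  show "inj (ellipse_map a b \<phi>)"
  proof (rule injI)
    fix y z assume "ellipse_map a b \<phi> y = ellipse_map a b \<phi> z"
    then have "a * y $ 1 = a * z $ 1" "b * y $ 2 = b * z $ 2"
      by (metis ellipse_map_coordinates)+
    then show "y = z" using assms by (simp add: vec_eq_iff forall_2)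
  qed
  show "surj (ellipse_map a b \<phi>)"
    by (rule surjI) (rule ellipse_map_inverse[OF assms])
qed

lemma solid_ellipse_body:
  "compact (solid_ellipse a b \<phi>)" "convex (solid_ellipse a b \<phi>)" "solid_ellipse a b \<phi> \<noteq> {}"
  unfolding solid_ellipse_def
  by (simp_all add: compact_continuous_image convex_linear_image linear_continuous_on
      linear_conv_bounded_linear[THEN iffD1] linear_ellipse_map)

text \<open>The map is a homeomorphism, so it carries the unit circle onto the frontier; in the
  coordinates along the two axes the circle has the stated equation.\<close>

lemma frontier_solid_ellipse:
  assumes ab: "a > 0" "b > 0"
  shows "frontier (solid_ellipse a b \<phi>) =
    {x. (x \<bullet> unit_normal \<phi>)\<^sup>2 / a\<^sup>2 + (x \<bullet> unit_normal (\<phi> + pi/2))\<^sup>2 / b\<^sup>2 = 1}"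
proof -
  let ?f = "ellipse_map a b \<phi>"
  have "frontier (solid_ellipse a b \<phi>) = ?f ` cball 0 1 - ?f ` ball 0 1"
    using compact_imp_closed[OF solid_ellipse_body(1), of a b \<phi>]
    by (simp add: frontier_def closure_closed solid_ellipse_def
        interior_bijective_linear_image[OF linear_ellipse_map bij_ellipse_map[OF ab]])
  also have "\<dots> = ?f ` sphere 0 1"
    using bij_is_inj[OF bij_ellipse_map[OF ab]]
    by (simp add: image_set_diff[symmetric] cball_diff_eq_sphere)
  also have "\<dots> = {x. (x \<bullet> unit_normal \<phi>)\<^sup>2 / a\<^sup>2 + (x \<bullet> unit_normal (\<phi> + pi/2))\<^sup>2 / b\<^sup>2 = 1}"
    (is "_ = ?E")
  proof -
    have mem: "?f y \<in> ?E \<longleftrightarrow> y \<in> sphere 0 1" for y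
    proof -
      have "?f y \<in> ?E \<longleftrightarrow> (y $ 1)\<^sup>2 + (y $ 2)\<^sup>2 = 1"
        using ab by (simp add: ellipse_map_coordinates power_mult_distrib)
      then show ?thesis
        by (simp add: norm_eq_sqrt_inner inner_plane power2_eq_square)
    qed
    show ?thesis
    proof (rule set_eqI)
      fix x
      obtain y where y: "x = ?f y"
        using ellipse_map_inverse[OF ab, of \<phi> x] by metis
      show "x \<in> ?f ` sphere 0 1 \<longleftrightarrow> x \<in> ?E"
        unfolding y mem by (rule inj_image_mem_iff[OF bij_is_inj[OF bij_ellipse_map[OF ab]]])
    qed
  qed
  finally show ?thesis .
qed

lemma centered_ellipse_iff:
  "centered_ellipse E \<longleftrightarrow> (\<exists>a b \<phi>. a > 0 \<and> b > 0 \<and> E = frontier (solid_ellipse a b \<phi>))"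
proof
  assume "centered_ellipse E"
  then obtain a b u v where ab: "a > 0" "b > 0" and uv: "norm u = 1" "norm v = 1" "u \<bullet> v = 0"
    and E: "E = {x. (x \<bullet> u)\<^sup>2 / a\<^sup>2 + (x \<bullet> v)\<^sup>2 / b\<^sup>2 = 1}"
    unfolding centered_ellipse_def by blast
  obtain \<phi> where u: "u = unit_normal \<phi>"
    using polar_form[of u] uv(1) by auto
  define c where "c = v \<bullet> unit_normal (\<phi> + pi/2)"
  have v: "v = c *\<^sub>R unit_normal (\<phi> + pi/2)"
    using unit_normal_frame(2)[of v \<phi>] uv(3) by (simp add: u c_def inner_commute)
  have "c\<^sup>2 = 1"
    using arg_cong[OF v, of norm] uv(2) by (simp add: abs_square_eq_1)
  then have "(x \<bullet> v)\<^sup>2 = (x \<bullet> unit_normal (\<phi> + pi/2))\<^sup>2" for x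
    by (simp add: v power_mult_distrib)
  then have "E = frontier (solid_ellipse a b \<phi>)"
    using ab by (simp add: frontier_solid_ellipse E u)
  with ab show "\<exists>a b \<phi>. a > 0 \<and> b > 0 \<and> E = frontier (solid_ellipse a b \<phi>)" by blast
next
  assume "\<exists>a b \<phi>. a > 0 \<and> b > 0 \<and> E = frontier (solid_ellipse a b \<phi>)"
  then obtain a b \<phi> where ab: "a > 0" "b > 0" "E = frontier (solid_ellipse a b \<phi>)" by blast
  have "unit_normal \<phi> \<bullet> unit_normal (\<phi> + pi/2) = 0"
    using unit_normal_frame(1) by (simp add: inner_commute)
  with ab show "centered_ellipse E"
    unfolding centered_ellipse_def frontier_solid_ellipse[OF ab(1,2)]
    by (intro exI[of _ a] exI[of _ b] exI[of _ "unit_normal \<phi>"]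
        exI[of _ "unit_normal (\<phi> + pi/2)"]) (simp add: frontier_solid_ellipse)
qed

lemma ellipse_support_pos:
  assumes "a > 0" "b > 0"
  shows "ellipse_support a b \<phi> \<theta> > 0"
proof -
  have "a * cos (\<theta> - \<phi>) \<noteq> 0 \<or> b * sin (\<theta> - \<phi>) \<noteq> 0"
    using assms sin_zero_abs_cos_one[of "\<theta> - \<phi>"] by auto
  then show ?thesis
    unfolding ellipse_support_def by (simp add: sum_power2_gt_zero_iff)
qed

text \<open>By duality this is the support function of the unit disc, that is the norm, at
  the image of the normal under the adjoint map.\<close>

lemma support_solid_ellipse: "support (solid_ellipse a b \<phi>) \<theta> = ellipse_support a b \<phi> \<theta>"
proof -
  define w :: "real^2" where "w = vector [a * cos (\<theta> - \<phi>), b * sin (\<theta> - \<phi>)]"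
  have dual: "ellipse_map a b \<phi> y \<bullet> unit_normal \<theta> = y \<bullet> w" for y
    by (simp add: ellipse_map_def w_def inner_plane[of y] inner_add_left inner_unit_normal
        cos_add cos_diff sin_diff sin_add algebra_simps)
  have w: "norm w = ellipse_support a b \<phi> \<theta>"
    by (simp add: w_def norm_eq_sqrt_inner inner_plane ellipse_support_def power2_eq_square)
  have "(SUP x\<in>ellipse_map a b \<phi> ` cball 0 1. x \<bullet> unit_normal \<theta>) = norm w"
  proof (rule cSup_eq_maximum)
    have "sgn w \<bullet> w = norm w"
      by (cases "w = 0") (simp_all add: sgn_div_norm power2_norm_eq_inner[symmetric] power2_eq_square)
    moreover have "sgn w \<in> cball 0 1" by (simp add: norm_sgn)
    ultimately show "norm w \<in> (\<lambda>x. x \<bullet> unit_normal \<theta>) ` ellipse_map a b \<phi> ` cball 0 1"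
      unfolding image_image dual by (metis imageI)
  next
    fix s assume "s \<in> (\<lambda>x. x \<bullet> unit_normal \<theta>) ` ellipse_map a b \<phi> ` cball 0 1"
    then obtain y where y: "norm y \<le> 1" "s = y \<bullet> w" by (auto simp: dual)
    have "y \<bullet> w \<le> norm y * norm w" by (rule norm_cauchy_schwarz)
    also have "\<dots> \<le> norm w" using y(1) by (simp add: mult_left_le_one_le)
    finally show "s \<le> norm w" using y(2) by simp
  qed
  then show ?thesis by (simp add: support_def solid_ellipse_def w)
qed

text \<open>Ellipses satisfy \<open>h\<^sup>3 (h'' + h) = (a b)\<^sup>2\<close>: the centro-affine curvature is constant. This is
  what makes the ratio to \<open>h\<close> the right unknown for comparison.\<close>

lemma ellipse_support_C2:
  assumes ab: "a > 0" "b > 0"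
  obtains h1 where
    "\<And>\<theta>. (ellipse_support a b \<phi> has_real_derivative h1 \<theta>) (at \<theta>)"
    "\<And>\<theta>. (h1 has_real_derivative
        (a * b)\<^sup>2 / ellipse_support a b \<phi> \<theta> ^ 3 - ellipse_support a b \<phi> \<theta>) (at \<theta>)"
proof -
  let ?h = "ellipse_support a b \<phi>"
  let ?c = "\<lambda>\<theta>. cos (\<theta> - \<phi>)" and ?s = "\<lambda>\<theta>. sin (\<theta> - \<phi>)"
  define h1 where "h1 \<theta> = (b\<^sup>2 - a\<^sup>2) * ?c \<theta> * ?s \<theta> / ?h \<theta>" for \<theta>
  have pos: "?h \<theta> > 0" for \<theta> by (rule ellipse_support_pos[OF ab])
  have sq: "(?h \<theta>)\<^sup>2 = (a * ?c \<theta>)\<^sup>2 + (b * ?s \<theta>)\<^sup>2" for \<theta>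
    by (simp add: ellipse_support_def)
  have dh: "(?h has_real_derivative h1 \<theta>) (at \<theta>)" for \<theta>
  proof -
    have "((\<lambda>\<theta>. (a * ?c \<theta>)\<^sup>2 + (b * ?s \<theta>)\<^sup>2) has_real_derivative
        2 * (b\<^sup>2 - a\<^sup>2) * ?c \<theta> * ?s \<theta>) (at \<theta>)"
      by (auto intro!: derivative_eq_intros simp: power2_eq_square algebra_simps)
    moreover have "0 < (a * ?c \<theta>)\<^sup>2 + (b * ?s \<theta>)\<^sup>2"
      using pos[of \<theta>] by (simp add: ellipse_support_def)
    ultimately have "(?h has_real_derivative
        inverse (?h \<theta>) / 2 * (2 * (b\<^sup>2 - a\<^sup>2) * ?c \<theta> * ?s \<theta>)) (at \<theta>)"
      unfolding ellipse_support_def[abs_def] by (intro DERIV_chain2[OF DERIV_real_sqrt])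
    moreover have "inverse y / 2 * (2 * A * c * d) = A * c * d / y" for y A c d :: real
      by (simp add: field_simps)
    ultimately show ?thesis by (simp only: h1_def)
  qed
  have dh1: "(h1 has_real_derivative (a * b)\<^sup>2 / ?h \<theta> ^ 3 - ?h \<theta>) (at \<theta>)" for \<theta>
  proof -
    let ?N = "(b\<^sup>2 - a\<^sup>2) * ((?c \<theta>)\<^sup>2 - (?s \<theta>)\<^sup>2)"
    have "((\<lambda>\<theta>. (b\<^sup>2 - a\<^sup>2) * ?c \<theta> * ?s \<theta>) has_real_derivative ?N) (at \<theta>)"
      by (auto intro!: derivative_eq_intros simp: power2_eq_square algebra_simps)
    from DERIV_divide[OF this dh] pos[of \<theta>]
    have "(h1 has_real_derivative
        (?N * ?h \<theta> - (b\<^sup>2 - a\<^sup>2) * ?c \<theta> * ?s \<theta> * h1 \<theta>) / (?h \<theta> * ?h \<theta>)) (at \<theta>)"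
      by (simp add: h1_def[abs_def])
    moreover have "(?N * ?h \<theta> - (b\<^sup>2 - a\<^sup>2) * ?c \<theta> * ?s \<theta> * h1 \<theta>) / (?h \<theta> * ?h \<theta>) =
        (a * b)\<^sup>2 / ?h \<theta> ^ 3 - ?h \<theta>"
    proof -
      have "?N * (?h \<theta>)\<^sup>2 - ((b\<^sup>2 - a\<^sup>2) * ?c \<theta> * ?s \<theta>)\<^sup>2 = (a * b)\<^sup>2 - ((?h \<theta>)\<^sup>2)\<^sup>2"
      proof -
        have "(?c \<theta>)\<^sup>2 = 1 - (?s \<theta>)\<^sup>2" by (rule cos_squared_eq)
        then show ?thesis
          unfolding sq power_mult_distrib by (simp only:) (simp add: power2_eq_square algebra_simps)
      qed
      then show ?thesis
        using pos[of \<theta>]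
        by (simp add: h1_def field_simps power2_eq_square power3_eq_cube)
    qed
    ultimately show ?thesis by simp
  qed
  show ?thesis by (rule that[OF dh dh1])
qed

lemma eq_solid_ellipseI:
  assumes "compact K" "convex K" "K \<noteq> {}" "\<And>\<theta>. support K \<theta> = ellipse_support a b \<phi> \<theta>"
  shows "K = solid_ellipse a b \<phi>"
  using assms solid_ellipse_body
  by (intro support_inject) (simp_all add: support_solid_ellipse)

text \<open>Multiplying the equation by \<open>s'\<close> gives the conserved energy \<open>s'\<^sup>2 + s\<^sup>2 + C / s\<^sup>2 = 2 E\<close>. With it,
  \<open>w = s\<^sup>2 - E\<close> satisfies \<open>w'' = - 4 w\<close>, hence is a combination of \<open>cos (2 \<theta>)\<close> and
  \<open>sin (2 \<theta>)\<close>, that is \<open>R cos (2 (\<theta> - \<phi>))\<close>. So \<open>s\<^sup>2\<close> takes its extreme values at \<open>\<phi>\<close> and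
  \<open>\<phi> + pi/2\<close>, and these are the squares of the semi-axes.\<close>

lemma ermakov_solution:
  fixes s s1 :: "real \<Rightarrow> real"
  assumes pos: "\<And>\<theta>. s \<theta> > 0"
    and ds: "\<And>\<theta>. (s has_real_derivative s1 \<theta>) (at \<theta>)"
    and ds1: "\<And>\<theta>. (s1 has_real_derivative C / s \<theta> ^ 3 - s \<theta>) (at \<theta>)"
  obtains a b \<phi> where "a > 0" "b > 0" "\<And>\<theta>. s \<theta> = ellipse_support a b \<phi> \<theta>"
proof -
  have nz: "s \<theta> \<noteq> 0" for \<theta> using pos[of \<theta>] by simp
  define e where "e \<theta> = (s1 \<theta>)\<^sup>2 + (s \<theta>)\<^sup>2 + C / (s \<theta>)\<^sup>2" for \<theta>
  have "(e has_real_derivative 0) (at \<theta>)" for \<theta>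
    unfolding e_def[abs_def] using nz[of \<theta>]
    by (auto intro!: derivative_eq_intros ds ds1
        simp: field_simps power2_eq_square power3_eq_cube)
  then have e: "e \<theta> = e 0" for \<theta>
    by (intro DERIV_isconst_all) blast
  define E where "E = e 0 / 2"
  have E: "s1 \<theta> * s1 \<theta> = 2 * E - s \<theta> * s \<theta> - C / (s \<theta> * s \<theta>)" for \<theta>
  proof -
    have "e \<theta> = 2 * E" using e[of \<theta>] by (simp add: E_def)
    then show ?thesis by (simp add: e_def power2_eq_square)
  qed
  \<comment> \<open>\<open>P\<close> and \<open>Q\<close> are the coordinates of \<open>(w, w' / 2)\<close> in a frame that
    rotates with the flow of \<open>w'' = - 4 w\<close>, hence constants of motion.\<close>
  define P where "P \<theta> = (s \<theta> * s \<theta> - E) * cos (2*\<theta>) - s \<theta> * s1 \<theta> * sin (2*\<theta>)" for \<theta>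
  define Q where "Q \<theta> = (s \<theta> * s \<theta> - E) * sin (2*\<theta>) + s \<theta> * s1 \<theta> * cos (2*\<theta>)" for \<theta>
  have s_ds1: "(C / s \<theta> ^ 3 - s \<theta>) * s \<theta> = C / (s \<theta> * s \<theta>) - s \<theta> * s \<theta>" for \<theta>
    using nz[of \<theta>] by (simp add: field_simps power3_eq_cube)
  have prod: "((\<lambda>\<theta>. s \<theta> * s1 \<theta>) has_real_derivative 2 * E - 2 * (s \<theta> * s \<theta>)) (at \<theta>)" for \<theta>
    by (rule DERIV_cong[OF DERIV_mult[OF ds ds1]]) (use E[of \<theta>] s_ds1[of \<theta>] in linarith)
  have sq: "((\<lambda>\<theta>. s \<theta> * s \<theta> - E) has_real_derivative 2 * (s \<theta> * s1 \<theta>)) (at \<theta>)" for \<theta>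
    by (auto intro!: derivative_eq_intros ds)
  have c2: "((\<lambda>\<theta>. cos (2*\<theta>)) has_real_derivative - 2 * sin (2*\<theta>)) (at \<theta>)"
    and s2: "((\<lambda>\<theta>. sin (2*\<theta>)) has_real_derivative 2 * cos (2*\<theta>)) (at \<theta>)" for \<theta> :: real
    by (auto intro!: derivative_eq_intros)
  have "(P has_real_derivative 0) (at \<theta>)" for \<theta>
    unfolding P_def[abs_def]
    by (rule DERIV_cong[OF DERIV_diff[OF DERIV_mult[OF sq c2] DERIV_mult[OF prod s2]]])
       (simp add: algebra_simps)
  then have P: "P \<theta> = P 0" for \<theta>
    by (intro DERIV_isconst_all) blast
  have "(Q has_real_derivative 0) (at \<theta>)" for \<theta>
    unfolding Q_def[abs_def]
    by (rule DERIV_cong[OF DERIV_add[OF DERIV_mult[OF sq s2] DERIV_mult[OF prod c2]]])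
       (simp add: algebra_simps)
  then have Q: "Q \<theta> = Q 0" for \<theta>
    by (intro DERIV_isconst_all) blast
  obtain \<psi> where \<psi>: "vector [P 0, Q 0] = norm (vector [P 0, Q 0] :: real^2) *\<^sub>R unit_normal \<psi>"
    by (rule polar_form)
  define R where "R = norm (vector [P 0, Q 0] :: real^2)"
  have R: "P 0 = R * cos \<psi>" "Q 0 = R * sin \<psi>"
    using arg_cong[OF \<psi>, of "\<lambda>v. v $ 1"] arg_cong[OF \<psi>, of "\<lambda>v. v $ 2"]
    unfolding R_def[symmetric] by simp_all
  define \<phi> where "\<phi> = \<psi> / 2"
  have s_sq: "(s \<theta>)\<^sup>2 = E + R * cos (2 * (\<theta> - \<phi>))" for \<theta>
  proof -
    have rotation: "w * (c\<^sup>2 + d\<^sup>2) = (w * c - x * d) * c + (w * d + x * c) * d" for w x c d :: real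
      by (simp add: power2_eq_square algebra_simps)
    have "(s \<theta>)\<^sup>2 - E = (s \<theta> * s \<theta> - E) * ((cos (2*\<theta>))\<^sup>2 + (sin (2*\<theta>))\<^sup>2)"
      by (simp only: sin_cos_squared_add2 mult_1_right power2_eq_square[of "s \<theta>"])
    also have "\<dots> = P \<theta> * cos (2*\<theta>) + Q \<theta> * sin (2*\<theta>)"
      unfolding P_def Q_def by (rule rotation)
    also have "\<dots> = R * cos (2*\<theta> - \<psi>)"
      unfolding P[of \<theta>] Q[of \<theta>] R by (simp add: cos_diff algebra_simps)
    finally show ?thesis by (simp add: \<phi>_def algebra_simps)
  qed
  define a b where "a = s \<phi>" and "b = s (\<phi> + pi/2)"
  have ab: "a > 0" "b > 0" "a\<^sup>2 = E + R" "b\<^sup>2 = E - R"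
    using pos s_sq[of \<phi>] s_sq[of "\<phi> + pi/2"] by (simp_all add: a_def b_def)
  have "s \<theta> = ellipse_support a b \<phi> \<theta>" for \<theta>
  proof -
    have "(s \<theta>)\<^sup>2 = (a * cos (\<theta> - \<phi>))\<^sup>2 + (b * sin (\<theta> - \<phi>))\<^sup>2"
      unfolding s_sq cos_double power_mult_distrib ab(3,4) cos_squared_eq
      by (simp add: algebra_simps)
    then show ?thesis
      unfolding ellipse_support_def using pos[of \<theta>] by (metis less_imp_le real_sqrt_unique)
  qed
  with ab(1,2) show ?thesis by (rule that)
qed

section \<open>The flow\<close>

text \<open>With this factorization \<open>s\<^sub>t / s\<close> is a function of the centro-affine quantity \<open>s\<^sup>3 r\<close>
  alone.\<close>

lemma flow_speed:
  fixes s r p :: real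
  assumes "s > 0" "p > 0"
  shows "s powr (1 - 3 * p / (p + 2)) * r powr (- (p / (p + 2))) =
    s * (s ^ 3 * r) powr (- (p / (p + 2)))"
proof -
  define \<alpha> where "\<alpha> = p / (p + 2)"
  have "s ^ 3 = s powr 3" using assms(1) by simp
  then have cube: "(s ^ 3) powr (- \<alpha>) = s powr (3 * (- \<alpha>))"
    by (simp only: powr_powr)
  have exponent: "1 - 3 * p / (p + 2) = 1 + 3 * (- \<alpha>)"
    by (simp add: \<alpha>_def)
  have "s powr (1 + 3 * (- \<alpha>)) = s * (s ^ 3) powr (- \<alpha>)"
    unfolding cube powr_add using assms(1) by simp
  then show ?thesis
    unfolding exponent \<alpha>_def[symmetric] by (simp only: powr_mult mult.assoc)
qed

lemma flow_derivative:
  assumes "p > 0" "centro_affine_flow p T K" "t \<in> {0..<T}"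
  shows "((\<lambda>\<tau>. support (K \<tau>) \<theta>) has_real_derivative
    - (support (K t) \<theta> *
       (support (K t) \<theta> ^ 3 * curvature_radius (K t) \<theta>) powr (- (p / (p + 2)))))
    (at t within {0..<T})"
proof -
  have "K t \<in> K_sym" using assms(2,3) by (simp add: centro_affine_flow_def)
  note speed = flow_speed[OF support_pos[OF this] assms(1)]
  show ?thesis
    unfolding speed[symmetric] using assms(2,3) by (simp only: centro_affine_flow_def)
qed

text \<open>The equation gives continuity in time for each fixed angle. The speed has a sign, so all bodies
  stay in the initial one, and their support functions are uniformly Lipschitz in the angle.
  The two facts together give joint continuity.\<close>

lemma flow_support_continuous:
  assumes p: "p > 0" and flow: "centro_affine_flow p T K"
  shows "continuous_on (UNIV \<times> {0..<T}) (\<lambda>(\<theta>, t). support (K t) \<theta>)"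
proof (cases "T > 0")
  case False
  then show ?thesis by simp
next
  case True
  have Ks: "K t \<in> K_sym" if "t \<in> {0..<T}" for t
    using flow that by (simp add: centro_affine_flow_def)
  have time: "continuous_on {0..<T} (\<lambda>t. support (K t) \<theta>)" for \<theta>
    unfolding continuous_on_eq_continuous_within
    by (intro ballI DERIV_continuous[OF flow_derivative[OF p flow]])
  have dec: "support (K t) \<theta> \<le> support (K 0) \<theta>" if t: "t \<in> {0..<T}" for t \<theta>
  proof (rule DERIV_nonpos_imp_decreasing_open[where f = "\<lambda>t. support (K t) \<theta>"])
    show "0 \<le> t" using t by simp
    show "continuous_on {0..t} (\<lambda>t. support (K t) \<theta>)"
      using t by (intro continuous_on_subset[OF time]) auto
    fix x assume x: "0 < x" "x < t"
    then have xT: "x \<in> {0..<T}" using t by auto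
    let ?D = "- (support (K x) \<theta> *
       (support (K x) \<theta> ^ 3 * curvature_radius (K x) \<theta>) powr (- (p / (p + 2))))"
    have "((\<lambda>t. support (K t) \<theta>) has_real_derivative ?D) (at x within {0<..<T})"
      by (rule DERIV_subset[OF flow_derivative[OF p flow xT]]) auto
    then have "((\<lambda>t. support (K t) \<theta>) has_real_derivative ?D) (at x)"
      using x t by (subst (asm) at_within_open) auto
    moreover have "?D \<le> 0"
      using support_pos[OF Ks[OF xT], of \<theta>] by simp
    ultimately show "\<exists>y. ((\<lambda>t. support (K t) \<theta>) has_real_derivative y) (at x) \<and> y \<le> 0"
      by blast
  qed
  have K0: "K 0 \<in> K_sym" using Ks True by simp
  obtain R where R: "\<And>x. x \<in> K 0 \<Longrightarrow> norm x \<le> R"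
    using compact_imp_bounded[OF K_symD(1)[OF K0]] by (auto simp: bounded_iff)
  have lip: "\<bar>support (K t) \<theta> - support (K t) \<phi>\<bar> \<le> R * norm (unit_normal \<theta> - unit_normal \<phi>)"
    if t: "t \<in> {0..<T}" for t \<theta> \<phi>
  proof (rule support_shift_le)
    have "K t \<subseteq> K 0"
      by (rule support_subset) (use K_symD[OF K0] K_symD[OF Ks[OF t]] dec[OF t] in blast)+
    then show "\<And>x. x \<in> K t \<Longrightarrow> norm x \<le> R"
      using R by blast
  qed (use K_symD[OF Ks[OF t]] in blast)+
  let ?S = "UNIV \<times> {0..<T} :: (real \<times> real) set"
  show ?thesis
    unfolding continuous_on_def
  proof
    fix q assume q: "q \<in> ?S"
    obtain \<theta>0 t0 where [simp]: "q = (\<theta>0, t0)" by force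
    have "((\<lambda>z. support (K (snd z)) (fst z) - support (K (snd z)) \<theta>0) \<longlongrightarrow> 0) (at q within ?S)"
    proof (rule Lim_null_comparison)
      show "eventually (\<lambda>z. norm (support (K (snd z)) (fst z) - support (K (snd z)) \<theta>0)
          \<le> R * norm (unit_normal (fst z) - unit_normal \<theta>0)) (at q within ?S)"
        using lip by (auto simp: eventually_at_filter intro!: always_eventually)
      have "continuous_on ?S (\<lambda>z. R * norm (unit_normal (fst z) - unit_normal \<theta>0))"
        by (intro continuous_intros continuous_on_compose2[OF continuous_on_unit_normal[of UNIV]])
           auto
      from this[unfolded continuous_on_def, rule_format, OF q]
      show "((\<lambda>z. R * norm (unit_normal (fst z) - unit_normal \<theta>0)) \<longlongrightarrow> 0) (at q within ?S)"
        by simp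
    qed
    moreover have "((\<lambda>z. support (K (snd z)) \<theta>0) \<longlongrightarrow> support (K t0) \<theta>0) (at q within ?S)"
    proof -
      have "continuous_on ?S (\<lambda>z. support (K (snd z)) \<theta>0)"
        by (rule continuous_on_compose2[OF time]) (auto intro: continuous_intros)
      from this[unfolded continuous_on_def, rule_format, OF q] show ?thesis by simp
    qed
    ultimately have "((\<lambda>z. (support (K (snd z)) (fst z) - support (K (snd z)) \<theta>0)
        + support (K (snd z)) \<theta>0) \<longlongrightarrow> 0 + support (K t0) \<theta>0) (at q within ?S)"
      by (rule tendsto_add)
    then show "((\<lambda>(\<theta>, t). support (K t) \<theta>) \<longlongrightarrow> (case q of (\<theta>, t) \<Rightarrow> support (K t) \<theta>))
        (at q within ?S)"
      by (simp add: case_prod_unfold)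
  qed
qed

section \<open>Homothetic solutions start from ellipses\<close>

text \<open>For a homothetic solution, \<open>s(\<theta>, t) s(0, 0) = s(0, t) s(\<theta>, 0)\<close>. Comparing the time derivatives
  of both sides at \<open>t = 0\<close> uses no differentiability of the scaling factor, and cancels
  everything except the power of \<open>s\<^sup>3 r\<close>.\<close>

lemma homothetic_imp_affine_curvature_constant:
  assumes p: "p > 0" and T: "T > 0" and flow: "centro_affine_flow p T K"
    and hom: "homothetic_solution T K"
  shows "support (K 0) \<theta> ^ 3 * curvature_radius (K 0) \<theta> =
    support (K 0) 0 ^ 3 * curvature_radius (K 0) 0"
proof -
  have K0: "K 0 \<in> K_sym" using flow T by (simp add: centro_affine_flow_def)
  obtain c where c: "c t > 0" "K t = (\<lambda>x. c t *\<^sub>R x) ` K 0" if "t \<in> {0..<T}" for t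
    using hom unfolding homothetic_solution_def by blast
  let ?s = "\<lambda>\<theta> t. support (K t) \<theta>"
  define F where "F \<theta> = ?s \<theta> 0 ^ 3 * curvature_radius (K 0) \<theta>" for \<theta>
  define \<alpha> where "\<alpha> = p / (p + 2)"
  have \<alpha>: "\<alpha> > 0" using p by (simp add: \<alpha>_def)
  have spos: "?s \<theta> 0 > 0" for \<theta> by (rule support_pos[OF K0])
  have Fpos: "F \<theta> > 0" for \<theta>
  proof -
    obtain s1 where "\<And>\<theta>. curvature_radius (K 0) \<theta> > 0"
      using K_sym_support_C2[OF K0] by metis
    then show ?thesis using spos by (simp add: F_def)
  qed
  have scale: "?s \<theta> t = c t * ?s \<theta> 0" if "t \<in> {0..<T}" for \<theta> t
    using c[OF that] support_scaleR[OF K_symD(1,3)[OF K0], of "c t" \<theta>] by simp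
  have cross: "?s \<theta> t * ?s 0 0 = ?s 0 t * ?s \<theta> 0" if "t \<in> {0..<T}" for t
    unfolding scale[OF that, of \<theta>] scale[OF that, of 0] by simp
  have "((\<lambda>t. ?s \<theta> t * ?s 0 0) has_real_derivative - (?s \<theta> 0 * F \<theta> powr (- \<alpha>)) * ?s 0 0)
      (at 0 within {0..<T})"
    using flow_derivative[OF p flow, of 0 \<theta>] T
    by (intro DERIV_cmult_right) (simp add: F_def \<alpha>_def)
  then have "((\<lambda>t. ?s 0 t * ?s \<theta> 0) has_real_derivative - (?s \<theta> 0 * F \<theta> powr (- \<alpha>)) * ?s 0 0)
      (at 0 within {0..<T})"
    by (rule has_field_derivative_transform_within[OF _ T])
       (use T cross in auto)
  moreover have "((\<lambda>t. ?s 0 t * ?s \<theta> 0) has_real_derivative - (?s 0 0 * F 0 powr (- \<alpha>)) * ?s \<theta> 0)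
      (at 0 within {0..<T})"
    using flow_derivative[OF p flow, of 0 0] T
    by (intro DERIV_cmult_right) (simp add: F_def \<alpha>_def)
  ultimately have "- (?s \<theta> 0 * F \<theta> powr (- \<alpha>)) * ?s 0 0 = - (?s 0 0 * F 0 powr (- \<alpha>)) * ?s \<theta> 0"
    using T
    by (intro vector_derivative_unique_within_closed_interval[of 0 "T/2" 0 "\<lambda>t. ?s 0 t * ?s \<theta> 0"])
       (auto simp flip: has_real_derivative_iff_has_vector_derivative intro: DERIV_subset)
  then have "F \<theta> powr (- \<alpha>) = F 0 powr (- \<alpha>)"
    using spos[of 0] spos[of \<theta>] by simp
  then have "(F \<theta> powr (- \<alpha>)) powr (- 1 / \<alpha>) = (F 0 powr (- \<alpha>)) powr (- 1 / \<alpha>)"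
    by simp
  then show ?thesis
    using \<alpha> Fpos[of \<theta>] Fpos[of 0] by (simp add: powr_powr F_def)
qed

lemma homothetic_imp_centered_ellipse:
  assumes p: "p > 0" and T: "T > 0" and flow: "centro_affine_flow p T K"
    and hom: "homothetic_solution T K"
  shows "centered_ellipse (frontier (K 0))"
proof -
  have K0: "K 0 \<in> K_sym" using flow T by (simp add: centro_affine_flow_def)
  obtain s1 where s1: "\<And>\<theta>. (support (K 0) has_real_derivative s1 \<theta>) (at \<theta>)"
    "\<And>\<theta>. (s1 has_real_derivative curvature_radius (K 0) \<theta> - support (K 0) \<theta>) (at \<theta>)"
    using K_sym_support_C2[OF K0] by metis
  define C where "C = support (K 0) 0 ^ 3 * curvature_radius (K 0) 0"
  have pos: "support (K 0) \<theta> > 0" for \<theta> by (rule support_pos[OF K0])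
  have "curvature_radius (K 0) \<theta> = C / support (K 0) \<theta> ^ 3" for \<theta>
    using homothetic_imp_affine_curvature_constant[OF assms, of \<theta>] pos[of \<theta>]
    by (simp add: C_def field_simps)
  with s1(2) have "(s1 has_real_derivative C / support (K 0) \<theta> ^ 3 - support (K 0) \<theta>) (at \<theta>)" for \<theta>
    by simp
  from ermakov_solution[OF pos s1(1) this] obtain a b \<phi> where
    ab: "a > 0" "b > 0" "\<And>\<theta>. support (K 0) \<theta> = ellipse_support a b \<phi> \<theta>" by metis
  have "K 0 = solid_ellipse a b \<phi>"
    using K_symD[OF K0] ab(3) by (intro eq_solid_ellipseI)
  with ab(1,2) show ?thesis
    unfolding centered_ellipse_iff by metis
qed

section \<open>Ellipses evolve homothetically\<close>

text \<open>If a convex body lies in another one and touches it, it curves at least as much at the point of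
  contact. Here \<open>f\<close> and \<open>g\<close> are the two support functions and \<open>F\<close> and \<open>G\<close> their radii of
  curvature at the point of contact.\<close>

lemma curvature_radius_le_at_contact:
  fixes f g :: "real \<Rightarrow> real"
  assumes f: "\<And>x. (f has_real_derivative f1 x) (at x)"
    "(f1 has_real_derivative F - f x0) (at x0)"
    and g: "\<And>x. (g has_real_derivative g1 x) (at x)"
    "(g1 has_real_derivative G - g x0) (at x0)"
    and le: "\<And>x. f x \<le> g x" and eq: "f x0 = g x0"
  shows "F \<le> G"
proof -
  have "0 \<le> (G - g x0) - (F - f x0)"
    by (rule second_derivative_nonneg_at_min
          [OF DERIV_diff[OF g(1) f(1)] DERIV_diff[OF g(2) f(2)]])
       (use le eq in simp)
  with eq show ?thesis by simp
qed

lemma unit_normal_representative: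
  obtains \<phi> where "\<phi> \<in> {0..2*pi}" "unit_normal \<phi> = unit_normal \<theta>"
proof -
  obtain \<phi> where "0 \<le> \<phi>" "\<phi> < 2 * pi" "cos \<theta> = cos \<phi>" "sin \<theta> = sin \<phi>"
    using sincos_total_2pi[of "cos \<theta>" "sin \<theta>"] by auto
  then show ?thesis by (intro that[of \<phi>]) (auto simp: unit_normal_def)
qed

text \<open>With \<open>u = s / h\<close>, the power \<open>4 \<alpha>\<close> is the one for which the homothetic solution is affine in
  time. The time derivative of \<open>v = u powr (4 \<alpha>) + k t\<close> is, up to the factor \<open>4 \<alpha>\<close>,
  \<open>C powr (- \<alpha>) - (h\<^sup>3 r / u) powr (- \<alpha>)\<close>, and comparison of curvatures
  at an extremum of \<open>u\<close> decides the order between \<open>h\<^sup>3 r / u\<close> and \<open>C\<close>.\<close>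

lemma ellipse_flow_support:
  assumes p: "p > 0" and flow: "centro_affine_flow p T K"
    and ab: "a > 0" "b > 0" and K0: "K 0 = solid_ellipse a b \<phi>"
    and t: "t \<in> {0..<T}"
  shows "(support (K t) \<theta> / ellipse_support a b \<phi> \<theta>) powr (4 * (p / (p + 2))) =
    1 - 4 * (p / (p + 2)) * ((a * b)\<^sup>2) powr (- (p / (p + 2))) * t"
proof -
  define \<alpha> where "\<alpha> = p / (p + 2)"
  have \<alpha>: "\<alpha> > 0" using p by (simp add: \<alpha>_def)
  define C where "C = (a * b)\<^sup>2"
  have C: "C > 0" using ab by (simp add: C_def)
  let ?h = "ellipse_support a b \<phi>"
  let ?s = "\<lambda>\<theta> t. support (K t) \<theta>"
  let ?r = "\<lambda>\<theta> t. curvature_radius (K t) \<theta>"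
  define u where "u \<theta> t = ?s \<theta> t / ?h \<theta>" for \<theta> t
  define k where "k = 4 * \<alpha> * C powr (- \<alpha>)"
  define v where "v \<theta> t = u \<theta> t powr (4 * \<alpha>) + k * t" for \<theta> t
  define D where "D \<theta> t = 4 * \<alpha> * (C powr (- \<alpha>) - (?h \<theta> ^ 3 * ?r \<theta> t / u \<theta> t) powr (- \<alpha>))"
    for \<theta> t
  have Ks: "K t \<in> K_sym" if "t \<in> {0..<T}" for t
    using flow that by (simp add: centro_affine_flow_def)
  have hpos: "?h \<theta> > 0" for \<theta> by (rule ellipse_support_pos[OF ab])
  have spos: "?s \<theta> t > 0" if "t \<in> {0..<T}" for \<theta> t
    by (rule support_pos[OF Ks[OF that]])
  have upos: "u \<theta> t > 0" if "t \<in> {0..<T}" for \<theta> t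
    using spos[OF that] hpos by (simp add: u_def)
  have rpos: "?r \<theta> t > 0" if "t \<in> {0..<T}" for \<theta> t
    using K_sym_support_C2[OF Ks[OF that]] by metis
  obtain h1 where h1: "\<And>\<theta>. (?h has_real_derivative h1 \<theta>) (at \<theta>)"
    "\<And>\<theta>. (h1 has_real_derivative C / ?h \<theta> ^ 3 - ?h \<theta>) (at \<theta>)"
    using ellipse_support_C2[OF ab] unfolding C_def by metis

  have deriv: "(v \<theta> has_real_derivative D \<theta> t) (at t within {0..<T})" if t: "t \<in> {0..<T}" for \<theta> t
  proof -
    let ?E = "(?s \<theta> t ^ 3 * ?r \<theta> t) powr (- \<alpha>)"
    have "(u \<theta> has_real_derivative - (?s \<theta> t * ?E) / ?h \<theta>) (at t within {0..<T})"
      unfolding u_def[abs_def] \<alpha>_def by (rule DERIV_cdivide[OF flow_derivative[OF p flow t]])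
    then have "((\<lambda>t. u \<theta> t powr (4 * \<alpha>)) has_real_derivative
        4 * \<alpha> * u \<theta> t powr (4 * \<alpha> - 1) * (- (?s \<theta> t * ?E) / ?h \<theta>)) (at t within {0..<T})"
      by (rule DERIV_chain2[where f = "\<lambda>z. z powr (4 * \<alpha>)" and g = "u \<theta>",
            OF has_real_derivative_powr[OF upos[OF t]]])
    moreover have "u \<theta> t powr (4 * \<alpha> - 1) * (- (?s \<theta> t * ?E) / ?h \<theta>) =
        - ((?h \<theta> ^ 3 * ?r \<theta> t / u \<theta> t) powr (- \<alpha>))"
    proof -
      have "u \<theta> t powr (4 * \<alpha> - 1) * (- (?s \<theta> t * ?E) / ?h \<theta>) =
          - (u \<theta> t powr (4 * \<alpha> - 1) * u \<theta> t * ?E)"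
        by (simp add: u_def)
      also have "u \<theta> t powr (4 * \<alpha> - 1) * u \<theta> t = u \<theta> t powr (4 * \<alpha>)"
        using upos[OF t, of \<theta>] by (simp add: powr_diff)
      also have "\<dots> = (1 / u \<theta> t ^ 4) powr (- \<alpha>)"
      proof -
        have "(1 / u \<theta> t ^ 4) = u \<theta> t powr (- 4)"
          using upos[OF t, of \<theta>] by (simp add: powr_minus divide_inverse)
        then show ?thesis by (simp add: powr_powr)
      qed
      also have "(1 / u \<theta> t ^ 4) powr (- \<alpha>) * ?E = (?h \<theta> ^ 3 * ?r \<theta> t / u \<theta> t) powr (- \<alpha>)"
      proof -
        have "?s \<theta> t = u \<theta> t * ?h \<theta>" using hpos[of \<theta>] by (simp add: u_def)
        then have "1 / u \<theta> t ^ 4 * (?s \<theta> t ^ 3 * ?r \<theta> t) = ?h \<theta> ^ 3 * ?r \<theta> t / u \<theta> t"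
          using upos[OF t, of \<theta>] by (simp add: field_simps power3_eq_cube power4_eq_xxxx)
        then show ?thesis by (simp flip: powr_mult)
      qed
      finally show ?thesis .
    qed
    ultimately have "((\<lambda>t. u \<theta> t powr (4 * \<alpha>)) has_real_derivative
        4 * \<alpha> * (- ((?h \<theta> ^ 3 * ?r \<theta> t / u \<theta> t) powr (- \<alpha>)))) (at t within {0..<T})"
      by (simp only: mult.assoc)
    then have "((\<lambda>t. u \<theta> t powr (4 * \<alpha>) + k * t) has_real_derivative
        4 * \<alpha> * (- ((?h \<theta> ^ 3 * ?r \<theta> t / u \<theta> t) powr (- \<alpha>))) + k * 1) (at t within {0..<T})"
      by (intro DERIV_add DERIV_cmult DERIV_ident)
    then show ?thesis
      by (simp add: v_def[abs_def] D_def k_def algebra_simps)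
  qed

  have cmult_h: "((\<lambda>\<psi>. m * ?h \<psi>) has_real_derivative m * h1 \<psi>) (at \<psi>)"
    "((\<lambda>\<psi>. m * h1 \<psi>) has_real_derivative m * C / ?h \<psi> ^ 3 - m * ?h \<psi>) (at \<psi>)" for m \<psi>
    using DERIV_cmult[OF h1(1), of m] DERIV_cmult[OF h1(2), of m]
    by (simp_all add: right_diff_distrib)

  \<comment> \<open>At a maximum of \<open>u\<close> the body touches \<open>u \<theta> t\<close> times the ellipse from inside, at a minimum
    from outside.\<close>
  have crit_max: "D \<theta> t \<le> 0" if t: "t \<in> {0..<T}" and max: "\<And>\<psi>. v \<psi> t \<le> v \<theta> t" for \<theta> t
  proof -
    have u_le: "u \<psi> t \<le> u \<theta> t" for \<psi>
      using max[of \<psi>] powr_less_mono2[of "4 * \<alpha>" "u \<theta> t" "u \<psi> t"] \<alpha> upos[OF t]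
      unfolding v_def by (smt (verit))
    have le: "?s \<psi> t \<le> u \<theta> t * ?h \<psi>" for \<psi>
      using u_le[of \<psi>] hpos[of \<psi>] unfolding u_def[of \<psi>] by (simp add: pos_divide_le_eq)
    obtain s1 where s1: "\<And>\<theta>. (support (K t) has_real_derivative s1 \<theta>) (at \<theta>)"
      "\<And>\<theta>. (s1 has_real_derivative ?r \<theta> t - ?s \<theta> t) (at \<theta>)"
      using K_sym_support_C2[OF Ks[OF t]] by metis
    have eq: "?s \<theta> t = u \<theta> t * ?h \<theta>" using hpos[of \<theta>] by (simp add: u_def)
    have "?r \<theta> t \<le> u \<theta> t * C / ?h \<theta> ^ 3"
      by (rule curvature_radius_le_at_contact[OF s1(1) s1(2) cmult_h(1) cmult_h(2) le eq])
    then have "?h \<theta> ^ 3 * ?r \<theta> t / u \<theta> t \<le> C"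
      using hpos[of \<theta>] upos[OF t, of \<theta>] by (simp add: field_simps)
    moreover have "0 < ?h \<theta> ^ 3 * ?r \<theta> t / u \<theta> t"
      using hpos[of \<theta>] upos[OF t, of \<theta>] rpos[OF t, of \<theta>] by simp
    ultimately have "C powr (- \<alpha>) \<le> (?h \<theta> ^ 3 * ?r \<theta> t / u \<theta> t) powr (- \<alpha>)"
      using \<alpha> by (intro powr_mono2') auto
    then show ?thesis
      using \<alpha> by (simp add: D_def mult_le_0_iff)
  qed

  have crit_min: "0 \<le> D \<theta> t" if t: "t \<in> {0..<T}" and min: "\<And>\<psi>. v \<theta> t \<le> v \<psi> t" for \<theta> t
  proof -
    have u_le: "u \<theta> t \<le> u \<psi> t" for \<psi>
      using min[of \<psi>] powr_less_mono2[of "4 * \<alpha>" "u \<psi> t" "u \<theta> t"] \<alpha> upos[OF t]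
      unfolding v_def by (smt (verit))
    have le: "u \<theta> t * ?h \<psi> \<le> ?s \<psi> t" for \<psi>
      using u_le[of \<psi>] hpos[of \<psi>] unfolding u_def[of \<psi>] by (simp add: pos_le_divide_eq)
    obtain s1 where s1: "\<And>\<theta>. (support (K t) has_real_derivative s1 \<theta>) (at \<theta>)"
      "\<And>\<theta>. (s1 has_real_derivative ?r \<theta> t - ?s \<theta> t) (at \<theta>)"
      using K_sym_support_C2[OF Ks[OF t]] by metis
    have eq: "u \<theta> t * ?h \<theta> = ?s \<theta> t" using hpos[of \<theta>] by (simp add: u_def)
    have "u \<theta> t * C / ?h \<theta> ^ 3 \<le> ?r \<theta> t"
      by (rule curvature_radius_le_at_contact[OF cmult_h(1) cmult_h(2) s1(1) s1(2) le eq])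
    then have "C \<le> ?h \<theta> ^ 3 * ?r \<theta> t / u \<theta> t"
      using hpos[of \<theta>] upos[OF t, of \<theta>] by (simp add: field_simps)
    then have "(?h \<theta> ^ 3 * ?r \<theta> t / u \<theta> t) powr (- \<alpha>) \<le> C powr (- \<alpha>)"
      using \<alpha> C by (intro powr_mono2') auto
    then show ?thesis
      using \<alpha> by (simp add: D_def)
  qed

  have cont: "continuous_on ({0..2*pi} \<times> {0..<T}) (\<lambda>(\<theta>, t). v \<theta> t)"
  proof -
    have s: "continuous_on ({0..2*pi} \<times> {0..<T}) (\<lambda>z. ?s (fst z) (snd z))"
      by (rule continuous_on_subset[OF flow_support_continuous
            [OF p flow, unfolded case_prod_unfold]]) auto
    have "continuous_on UNIV ?h"
      by (meson DERIV_isCont continuous_at_imp_continuous_on h1(1))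
    then have h: "continuous_on ({0..2*pi} \<times> {0..<T}) (\<lambda>z. ?h (fst z))"
      by (rule continuous_on_compose2) (auto intro: continuous_intros)
    have "continuous_on ({0..2*pi} \<times> {0..<T})
        (\<lambda>z. (?s (fst z) (snd z) / ?h (fst z)) powr (4 * \<alpha>) + k * snd z)"
    proof (intro continuous_intros s h ballI)
      fix z assume "z \<in> {0..2*pi} \<times> {0..<T}"
      then have "u (fst z) (snd z) > 0" by (intro upos) auto
      then show "?s (fst z) (snd z) / ?h (fst z) \<noteq> 0"
        unfolding u_def by (rule less_imp_neq[symmetric])
      show "?h (fst z) \<noteq> 0" using hpos[of "fst z"] by simp
    qed
    then show ?thesis
      by (simp add: v_def u_def case_prod_unfold)
  qed
  have per: "\<exists>\<psi>\<in>{0..2*pi}. \<forall>t\<in>{0..<T}. v \<theta> t = v \<psi> t" for \<theta>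
  proof -
    obtain \<psi> where \<psi>: "\<psi> \<in> {0..2*pi}" "unit_normal \<psi> = unit_normal \<theta>"
      by (rule unit_normal_representative)
    then have "support L \<theta> = support L \<psi>" for L by (simp add: support_def)
    then have "v \<theta> t = v \<psi> t" for t
      by (simp add: v_def u_def flip: support_solid_ellipse)
    with \<psi>(1) show ?thesis by blast
  qed
  have init: "v \<theta> 0 = 1" for \<theta>
    using hpos[of \<theta>] by (simp add: v_def u_def K0 support_solid_ellipse)
  have "v \<theta> t \<le> 1"
    by (rule parabolic_maximum_principle[OF cont per deriv crit_max _ t]) (simp_all add: init)
  moreover have "- v \<theta> t \<le> - 1"
  proof (rule parabolic_maximum_principle
      [where v = "\<lambda>\<theta> t. - v \<theta> t" and D = "\<lambda>\<theta> t. - D \<theta> t", OF _ _ _ _ _ t])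
    show "continuous_on ({0..2*pi} \<times> {0..<T}) (\<lambda>(\<theta>, t). - v \<theta> t)"
      using continuous_on_minus[OF cont] by (simp add: case_prod_unfold)
    show "\<exists>\<psi>\<in>{0..2*pi}. \<forall>t\<in>{0..<T}. - v \<theta> t = - v \<psi> t" for \<theta>
      using per[of \<theta>] by simp
  qed (use deriv crit_min init in \<open>auto intro: DERIV_minus\<close>)
  ultimately show ?thesis
    by (simp add: v_def u_def k_def \<alpha>_def C_def)
qed

lemma centered_ellipse_imp_homothetic:
  assumes p: "p > 0" and T: "T > 0" and flow: "centro_affine_flow p T K"
    and ell: "centered_ellipse (frontier (K 0))"
  shows "homothetic_solution T K"
proof -
  have Ks: "K t \<in> K_sym" if "t \<in> {0..<T}" for t
    using flow that by (simp add: centro_affine_flow_def)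
  then have K0: "K 0 \<in> K_sym" using T by simp
  obtain a b \<phi> where ab: "a > 0" "b > 0" and fr: "frontier (K 0) = frontier (solid_ellipse a b \<phi>)"
    using ell unfolding centered_ellipse_iff by blast
  \<comment> \<open>A compact convex set is the convex hull of its frontier.\<close>
  have K0_eq: "K 0 = solid_ellipse a b \<phi>"
    using Krein_Milman_frontier[OF K_symD(2,1)[OF K0]]
      Krein_Milman_frontier[OF solid_ellipse_body(2,1), of a b \<phi>] fr by simp
  let ?h = "ellipse_support a b \<phi>"
  define \<beta> where "\<beta> = 4 * (p / (p + 2))"
  have \<beta>: "\<beta> > 0" using p by (simp add: \<beta>_def)
  define c where "c t = (1 - \<beta> * ((a * b)\<^sup>2) powr (- (p / (p + 2))) * t) powr (1 / \<beta>)" for t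
  have hpos: "?h \<theta> > 0" for \<theta> by (rule ellipse_support_pos[OF ab])
  have root: "(w powr \<beta>) powr (1 / \<beta>) = w" if "w > 0" for w :: real
    using that \<beta> by (simp add: powr_powr)
  have "c t > 0 \<and> K t = (\<lambda>x. c t *\<^sub>R x) ` K 0" if t: "t \<in> {0..<T}" for t
  proof -
    have ratio: "support (K t) \<theta> / ?h \<theta> = c t" for \<theta>
    proof -
      have pos: "support (K t) \<theta> / ?h \<theta> > 0"
        using support_pos[OF Ks[OF t]] hpos by simp
      have "c t = ((support (K t) \<theta> / ?h \<theta>) powr \<beta>) powr (1 / \<beta>)"
        unfolding c_def \<beta>_def ellipse_flow_support[OF p flow ab K0_eq t] by (rule refl)
      also have "\<dots> = support (K t) \<theta> / ?h \<theta>"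
        by (rule root[OF pos])
      finally show ?thesis by simp
    qed
    have cpos: "c t > 0"
      using ratio[of 0] support_pos[OF Ks[OF t], of 0] hpos[of 0] by (metis divide_pos_pos)
    have sup: "support (K t) \<theta> = support ((\<lambda>x. c t *\<^sub>R x) ` K 0) \<theta>" for \<theta>
    proof -
      have "support (K t) \<theta> = c t * ?h \<theta>"
        using ratio[of \<theta>] hpos[of \<theta>] by (simp add: field_simps)
      also have "\<dots> = c t * support (K 0) \<theta>"
        by (simp add: K0_eq support_solid_ellipse)
      also have "\<dots> = support ((\<lambda>x. c t *\<^sub>R x) ` K 0) \<theta>"
        using support_scaleR[OF K_symD(1,3)[OF K0]] cpos by simp
      finally show ?thesis .
    qed
    have "K t = (\<lambda>x. c t *\<^sub>R x) ` K 0"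
    proof (rule support_inject[OF K_symD(1-3)[OF Ks[OF t]] _ _ _ sup])
      show "compact ((\<lambda>x. c t *\<^sub>R x) ` K 0)" by (rule compact_scaling[OF K_symD(1)[OF K0]])
      show "convex ((\<lambda>x. c t *\<^sub>R x) ` K 0)" by (rule convex_scaling[OF K_symD(2)[OF K0]])
      show "(\<lambda>x. c t *\<^sub>R x) ` K 0 \<noteq> {}" using K_symD(3)[OF K0] by simp
    qed
    with cpos show ?thesis by simp
  qed
  then show ?thesis unfolding homothetic_solution_def by blast
qed

theorem proposition2p11:
  fixes p T :: real and K :: "real \<Rightarrow> (real^2) set"
  assumes "p \<ge> 1" and "T > 0" and "centro_affine_flow p T K"
  shows "homothetic_solution T K \<longleftrightarrow> centered_ellipse (frontier (K 0))"
proof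
  have p: "p > 0" using assms(1) by simp
  show "centered_ellipse (frontier (K 0))" if "homothetic_solution T K"
    using homothetic_imp_centered_ellipse[OF p assms(2,3) that] .
  show "homothetic_solution T K" if "centered_ellipse (frontier (K 0))"
    using centered_ellipse_imp_homothetic[OF p assms(2,3) that] .
qed

end
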